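(* Let $\kappa$ be a cardinal and $\lambda$ an infinite cardinal, and let $h\colon B(\kappa,\lambda)\to B$ be a homomorphism of the boolean algebra $B(\kappa,\lambda)$ onto a boolean algebra $B$. Then (i) either $|B|<2^\lambda$ or $|B|^\lambda=|B|$; (ii) if $X$ is the Stone space of $B$ (the space of ultrafilters of $B$), then either $|X|\le 2^{2^\lambda}$ or $|X|=|B|=|B|^\lambda$.
   Context: $B(\kappa,\lambda)$ denotes the boolean subalgebra of the power set algebra $\mathcal{P}(\kappa)$ generated by all subsets of $\kappa$ of size $\le\lambda$; for infinite $\lambda$ it equals $[\kappa]^{\le\lambda}\cup\{x\subset\kappa\colon \kappa\setminus x\in[\kappa]^{\le\lambda}\}$, where $[\kappa]^{\le\lambda}$ is the set of subsets of $\kappa$ of cardinality at most $\lambda$. *)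

theory Defs
  imports "HOL-Analysis.Analysis"
begin

unbundle cardinal_syntax

text \<open>Cardinals are cardinal orders in the sense of the BNF cardinal library;
  the underlying set of a cardinal is its field.\<close>

text \<open>The algebra \<open>B(kappa, lambda)\<close> is the least algebra of subsets of
  \<open>Field kappa\<close> containing all sets of size at most \<open>lambda\<close>.\<close>

definition small_sets :: "'k rel \<Rightarrow> 'l rel \<Rightarrow> 'k set set" where
  "small_sets kappa lambda = {x. x \<subseteq> Field kappa \<and> |x| \<le>o lambda}"

definition B_alg :: "'k rel \<Rightarrow> 'l rel \<Rightarrow> 'k set set" where
  "B_alg kappa lambda = algebra (Field kappa) hull small_sets kappa lambda"

text \<open>The function \<open>h\<close> is total, but only its values on \<open>M\<close> are constrained.\<close>

definition set_algebra_hom :: "'k set \<Rightarrow> 'k set set \<Rightarrow> ('k set \<Rightarrow> 'b::boolean_algebra) \<Rightarrow> bool" where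
  "set_algebra_hom \<Omega> M h \<longleftrightarrow>
     h {} = bot \<and> h \<Omega> = top \<and>
     (\<forall>x\<in>M. h (\<Omega> - x) = - h x) \<and>
     (\<forall>x\<in>M. \<forall>y\<in>M. h (x \<union> y) = sup (h x) (h y) \<and> h (x \<inter> y) = inf (h x) (h y))"

definition proper_filter :: "'b::boolean_algebra set \<Rightarrow> bool" where
  "proper_filter F \<longleftrightarrow>
     top \<in> F \<and> bot \<notin> F \<and>
     (\<forall>a\<in>F. \<forall>b. a \<le> b \<longrightarrow> b \<in> F) \<and>
     (\<forall>a\<in>F. \<forall>b\<in>F. inf a b \<in> F)"

definition ultrafilter :: "'b::boolean_algebra set \<Rightarrow> bool" where
  "ultrafilter U \<longleftrightarrow> proper_filter U \<and> (\<forall>F. proper_filter F \<and> U \<subseteq> F \<longrightarrow> F = U)"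

text \<open>The points are the ultrafilters; the sets of ultrafilters containing a given
  element form a subbase (in fact a base). The trivial algebra with \<open>bot = top\<close> is a
  legitimate instance of \<open>boolean_algebra\<close>, and its Stone space is empty.\<close>

definition stone_space :: "'b::boolean_algebra set topology" where
  "stone_space = topology_generated_by (range (\<lambda>b. {U. ultrafilter U \<and> b \<in> U}))"

lemma topspace_stone_space:
  "topspace (stone_space :: 'b::boolean_algebra set topology) = {U. ultrafilter U}"
  by (auto simp: stone_space_def ultrafilter_def proper_filter_def)

lemma algebra_B_alg: "algebra (Field kappa) (B_alg kappa lambda)"
proof -
  have "algebra (Field kappa) (Pow (Field kappa))"
    by (rule algebra_Pow)
  moreover have "small_sets kappa lambda \<subseteq> Pow (Field kappa)"
    by (auto simp: small_sets_def)
  ultimately have ex: "\<exists>M. algebra (Field kappa) M \<and> small_sets kappa lambda \<subseteq> M"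
    by blast
  show ?thesis
    unfolding B_alg_def hull_def algebra_iff_Un[of _ "\<Inter> _"]
  proof (intro conjI ballI)
    show "\<Inter> {t. algebra (Field kappa) t \<and> small_sets kappa lambda \<subseteq> t} \<subseteq> Pow (Field kappa)"
      using ex unfolding algebra_iff_Un by blast
  qed (auto simp: algebra_iff_Un)
qed

text \<open>For infinite \<open>lambda\<close> the generated algebra consists of the small and co-small sets.\<close>

lemma B_alg_explicit:
  assumes "Cinfinite lambda"
  shows "B_alg kappa lambda =
    small_sets kappa lambda \<union> {x. x \<subseteq> Field kappa \<and> Field kappa - x \<in> small_sets kappa lambda}"
    (is "_ = ?R")
proof -
  have Un: "x \<union> y \<in> small_sets kappa lambda"
    if "x \<in> small_sets kappa lambda" "y \<in> small_sets kappa lambda" for x y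
    using that assms card_of_Un_ordLeq_infinite_Field[of lambda x y]
    by (auto simp: small_sets_def cinfinite_def)
  have sub: "x \<in> small_sets kappa lambda" if "y \<in> small_sets kappa lambda" "x \<subseteq> y" for x y
    using that card_of_mono1[of x y] ordLeq_transitive[of "|x|" "|y|" lambda]
    by (auto simp: small_sets_def)
  have "{} \<in> small_sets kappa lambda"
    using assms by (auto simp: small_sets_def card_of_empty1 card_order_on_well_order_on)
  then have "algebra (Field kappa) ?R"
    unfolding algebra_iff_Un
  proof (intro conjI ballI)
    show "?R \<subseteq> Pow (Field kappa)" by (auto simp: small_sets_def)
    show "{} \<in> ?R" by (rule UnI1) fact
    show "Field kappa - a \<in> ?R" if "a \<in> ?R" for a
    proof -
      have "a \<subseteq> Field kappa" using that by (auto simp: small_sets_def)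
      then have "Field kappa - (Field kappa - a) = a" by blast
      with that show ?thesis by auto
    qed
    show "a \<union> b \<in> ?R" if ab_R: "a \<in> ?R" "b \<in> ?R" for a b
    proof -
      have ab: "a \<union> b \<subseteq> Field kappa" using that by (auto simp: small_sets_def)
      consider "a \<in> small_sets kappa lambda" "b \<in> small_sets kappa lambda"
        | "Field kappa - a \<in> small_sets kappa lambda"
        | "Field kappa - b \<in> small_sets kappa lambda"
        using ab_R by blast
      then show ?thesis
      proof cases
        case 1 then show ?thesis using Un by blast
      next
        case 2 then have "Field kappa - (a \<union> b) \<in> small_sets kappa lambda"
          by (rule sub) auto
        then show ?thesis using ab by blast
      next
        case 3 then have "Field kappa - (a \<union> b) \<in> small_sets kappa lambda"
          by (rule sub) auto
        then show ?thesis using ab by blast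
      qed
    qed
  qed
  then have "B_alg kappa lambda \<subseteq> ?R"
    unfolding B_alg_def by (intro hull_minimal) auto
  moreover have "small_sets kappa lambda \<subseteq> B_alg kappa lambda"
    unfolding B_alg_def by (rule hull_subset)
  then have "?R \<subseteq> B_alg kappa lambda"
  proof (intro Un_least subsetI)
    fix x assume sm: "small_sets kappa lambda \<subseteq> B_alg kappa lambda"
      and x: "x \<in> {x. x \<subseteq> Field kappa \<and> Field kappa - x \<in> small_sets kappa lambda}"
    then have "Field kappa - (Field kappa - x) \<in> B_alg kappa lambda"
      using algebra_B_alg[of kappa lambda] unfolding algebra_iff_Un by blast
    moreover have "Field kappa - (Field kappa - x) = x" using x by blast
    ultimately show "x \<in> B_alg kappa lambda" by simp
  qed auto
  ultimately show ?thesis by (rule equalityI)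
qed

end

theory Submission
  imports Defs
begin

text \<open>Let \<open>J\<close> be the image under \<open>h\<close> of the ideal of sets of size at most \<open>lambda\<close>; then
  every element of the quotient lies in \<open>J\<close> or has its complement there. Take a maximal disjoint
  family \<open>D\<close> of small sets with nonzero image. By maximality \<open>h\<close> ignores everything
  outside \<open>\<Union>D\<close>. If \<open>|D| \<le> lambda\<close>, the quotient has at most \<open>2^lambda\<close> elements. Otherwise unions of
  at most \<open>lambda\<close> members of \<open>D\<close> are small and have distinct images, so the quotient has exactly
  \<open>|D|^lambda\<close> elements.

  For the Stone space: at most one ultrafilter misses \<open>J\<close>, and an ultrafilter containing \<open>j \<in> J\<close> is
  determined by its trace on the at most \<open>2^lambda\<close> elements below \<open>j\<close>; so there are at most
  \<open>max |B| 2^2^lambda\<close> ultrafilters, while an infinite Stone space has at least \<open>|B|\<close> points.\<close>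

section \<open>Counting finite lists\<close>

lemma singleton_Cinfinite_bound: "Cinfinite r \<Longrightarrow> |{x}| \<le>o r"
  by (metis Card_order_singl_ordLeq cinfinite_def finite.emptyI)

text \<open>By induction there are at most \<open>r\<close> lists of each length, because an
  infinite cardinal absorbs its products with smaller or equal ones; and there are only countably
  many lengths.\<close>

lemma card_of_lists_ordLeq:
  assumes r: "Cinfinite r" and A: "|A| \<le>o r"
  shows "|lists A| \<le>o r"
proof -
  have len: "|{xs \<in> lists A. length xs = n}| \<le>o r" for n
  proof (induction n)
    case 0
    have "{xs \<in> lists A. length xs = 0} = {[]}" by auto
    then show ?case
      using r singleton_Cinfinite_bound by metis
  next
    case (Suc n)
    have "{xs \<in> lists A. length xs = Suc n}
        \<subseteq> (\<lambda>(x, xs). x # xs) ` (A \<times> {xs \<in> lists A. length xs = n})"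
      by (auto simp: image_iff length_Suc_conv)
    moreover have "|A \<times> {xs \<in> lists A. length xs = n}| \<le>o r"
      using r A Suc by (auto simp: cinfinite_def intro: card_of_Times_ordLeq_infinite_Field)
    ultimately show ?case by (blast intro: surj_imp_ordLeq ordLeq_transitive)
  qed
  have "|UNIV :: nat set| \<le>o r"
    using r by (simp add: cinfinite_def infinite_iff_card_of_nat)
      (metis card_of_Field_ordIso ordLeq_ordIso_trans)
  then have "|\<Union>n\<in>UNIV. {xs \<in> lists A. length xs = n}| \<le>o r"
    using len r by (intro UNION_Cinfinite_bound) auto
  moreover have "(\<Union>n\<in>UNIV. {xs \<in> lists A. length xs = n}) = lists A" by auto
  ultimately show ?thesis by simp
qed

section \<open>Finite meets, filters and ultrafilters\<close>

lemma foldr_inf_top: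
  fixes xs :: "'b::boolean_algebra list"
  shows "foldr inf xs a = inf (foldr inf xs top) a"
  by (induction xs) (auto simp: inf_assoc)

lemma foldr_inf_uminus:
  fixes xs :: "'b::boolean_algebra list"
  shows "foldr inf (map uminus xs) top = - foldr sup xs bot"
  by (induction xs) auto

lemma proper_filterD:
  assumes "proper_filter F"
  shows "top \<in> F" "bot \<notin> F" "a \<in> F \<Longrightarrow> a \<le> b \<Longrightarrow> b \<in> F"
    "a \<in> F \<Longrightarrow> b \<in> F \<Longrightarrow> inf a b \<in> F"
  using assms unfolding proper_filter_def by blast+

lemma foldr_inf_mem_filter:
  "proper_filter F \<Longrightarrow> xs \<in> lists F \<Longrightarrow> foldr inf xs top \<in> F"
  by (induction xs) (auto simp: proper_filter_def)

lemma foldr_sup_least: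
  fixes b :: "'b::boolean_algebra"
  shows "(\<And>x. x \<in> set xs \<Longrightarrow> x \<le> b) \<Longrightarrow> foldr sup xs bot \<le> b"
  by (induction xs) auto

text \<open>Idempotence merges all occurrences of \<open>b\<close> into one. So a vanishing finite
  meet from \<open>insert b S\<close> yields a finite meet from \<open>S\<close> that is disjoint
  from \<open>b\<close>.\<close>

lemma foldr_inf_insert:
  fixes b :: "'b::boolean_algebra"
  assumes "xs \<in> lists (insert b S)"
  shows "\<exists>ys \<in> lists S. inf b (foldr inf ys top) \<le> foldr inf xs top"
  using assms
proof (induction xs)
  case Nil
  then show ?case by (intro bexI[of _ "[]"]) auto
next
  case (Cons x xs)
  then obtain ys where ys: "ys \<in> lists S" "inf b (foldr inf ys top) \<le> foldr inf xs top"
    by auto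
  have x: "x \<in> insert b S" using Cons by auto
  show ?case
  proof (cases "x = b")
    case True
    then show ?thesis using ys by (intro bexI[of _ ys]) (auto simp: le_infI1)
  next
    case False
    with x ys show ?thesis
      by (intro bexI[of _ "x # ys"])
        (auto simp: inf_left_commute[of b x] intro: le_infI2)
  qed
qed

text \<open>The hypothesis is the finite intersection property: it makes the filter generated by
  \<open>S\<close> proper, and Zorn's lemma enlarges that filter to a maximal one.\<close>

lemma ultrafilter_extends:
  fixes S :: "'b::boolean_algebra set"
  assumes S: "\<And>xs. xs \<in> lists S \<Longrightarrow> foldr inf xs top \<noteq> bot"
  obtains U where "ultrafilter U" "S \<subseteq> U"
proof -
  define F where "F = {b. \<exists>xs\<in>lists S. foldr inf xs top \<le> b}"
  have F: "proper_filter F"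
    unfolding proper_filter_def
  proof (intro conjI ballI allI impI)
    show "top \<in> F" unfolding F_def by (auto intro!: bexI[of _ "[]"])
    show "bot \<notin> F" using S by (auto simp: F_def bot_unique)
    show "b \<in> F" if "a \<in> F" "a \<le> b" for a b
      using that unfolding F_def by (auto intro: order_trans)
    show "inf a b \<in> F" if ab: "a \<in> F" "b \<in> F" for a b
    proof -
      obtain xs ys where "xs \<in> lists S" "foldr inf xs top \<le> a"
        "ys \<in> lists S" "foldr inf ys top \<le> b"
        using ab by (auto simp: F_def)
      then show ?thesis unfolding F_def
        using foldr_inf_top[of xs "foldr inf ys top"]
        by (auto intro!: bexI[of _ "xs @ ys"] intro: le_infI1 le_infI2)
    qed
  qed
  have "\<exists>U\<in>{G. proper_filter G \<and> F \<subseteq> G}. \<forall>X\<in>{G. proper_filter G \<and> F \<subseteq> G}. U \<subseteq> X \<longrightarrow> X = U"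
  proof (rule subset_Zorn_nonempty)
    show "{G. proper_filter G \<and> F \<subseteq> G} \<noteq> {}" using F by auto
    fix \<C> assume ne: "\<C> \<noteq> {}" and ch: "subset.chain {G. proper_filter G \<and> F \<subseteq> G} \<C>"
    have pf: "proper_filter G" "F \<subseteq> G" if "G \<in> \<C>" for G
      using ch that by (auto simp: subset_chain_def)
    have "inf a b \<in> \<Union>\<C>" if ab: "a \<in> \<Union>\<C>" "b \<in> \<Union>\<C>" for a b
    proof -
      obtain G H where GH: "G \<in> \<C>" "a \<in> G" "H \<in> \<C>" "b \<in> H"
        using ab by blast
      then have "G \<subseteq> H \<or> H \<subseteq> G" using ch by (simp add: subset_chain_def)
      then obtain G where "G \<in> \<C>" "a \<in> G" "b \<in> G"
        using GH by blast
      then show ?thesis using proper_filterD(4)[OF pf(1)] by blast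
    qed
    moreover have "top \<in> \<Union>\<C>" "bot \<notin> \<Union>\<C>"
      using ne proper_filterD(1,2)[OF pf(1)] by auto
    moreover have "b \<in> \<Union>\<C>" if "a \<in> \<Union>\<C>" "a \<le> b" for a b
      using that proper_filterD(3)[OF pf(1)] by blast
    ultimately have "proper_filter (\<Union>\<C>)"
      by (simp only: proper_filter_def) blast
    then show "\<Union>\<C> \<in> {G. proper_filter G \<and> F \<subseteq> G}" using ne pf(2) by blast
  qed
  then obtain U where U: "proper_filter U" "F \<subseteq> U"
    and max: "\<And>X. proper_filter X \<Longrightarrow> F \<subseteq> X \<Longrightarrow> U \<subseteq> X \<Longrightarrow> X = U"
    by auto
  have "S \<subseteq> F" unfolding F_def by (auto intro!: bexI[of _ "[_]"])
  \<comment> \<open>A proper filter above \<open>U\<close> also contains \<open>F\<close>, so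
    maximality among the filters above \<open>F\<close> is maximality among all proper
    filters.\<close>
  moreover have "ultrafilter U" using U max unfolding ultrafilter_def by blast
  ultimately show ?thesis using that U by blast
qed

text \<open>If \<open>b\<close> and \<open>- b\<close> were both outside \<open>U\<close>, the
  filter generated by \<open>U\<close> and \<open>b\<close> would properly extend \<open>U\<close>;
  it is proper because \<open>inf u b = bot\<close> means \<open>u \<le> - b\<close>.\<close>

lemma ultrafilter_uminus:
  assumes U: "ultrafilter U"
  shows "- b \<in> U \<longleftrightarrow> b \<notin> U"
proof
  have pf: "proper_filter U" using U by (simp add: ultrafilter_def)
  show "b \<notin> U" if "- b \<in> U"
    using that pf unfolding proper_filter_def by (metis inf_compl_bot)
  show "- b \<in> U" if b: "b \<notin> U"
  proof (rule ccontr)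
    assume nb: "- b \<notin> U"
    define F where "F = {c. \<exists>u\<in>U. inf u b \<le> c}"
    have "proper_filter F"
      unfolding proper_filter_def
    proof (intro conjI ballI allI impI)
      show "top \<in> F" using pf by (auto simp: F_def proper_filter_def)
      show "bot \<notin> F"
        using pf nb unfolding F_def proper_filter_def
        by (auto simp: bot_unique inf_shunt)
      show "d \<in> F" if "c \<in> F" "c \<le> d" for c d
        using that unfolding F_def by (auto intro: order_trans)
      show "inf c d \<in> F" if cd: "c \<in> F" "d \<in> F" for c d
      proof -
        obtain u v where "u \<in> U" "inf u b \<le> c" "v \<in> U" "inf v b \<le> d"
          using cd by (auto simp: F_def)
        moreover from this have "inf (inf u v) b \<le> inf c d"
          by (meson inf.boundedI inf_le1 inf_le2 le_infI1 order_trans inf_mono order_refl)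
        ultimately show ?thesis using pf unfolding F_def proper_filter_def by blast
      qed
    qed
    moreover have "U \<subseteq> F" unfolding F_def by (auto intro: le_infI1)
    ultimately have "F = U" using U by (simp add: ultrafilter_def)
    moreover have "b \<in> F"
      using pf unfolding F_def proper_filter_def by auto
    ultimately show False using b by simp
  qed
qed

text \<open>Elements separating the pairs of ultrafilters generate the algebra, by compactness.\<close>

lemma card_of_algebra_ordLeq_ultrafilters:
  assumes r: "Cinfinite r" and X: "|{U :: 'b::boolean_algebra set. ultrafilter U}| \<le>o r"
  shows "|UNIV :: 'b set| \<le>o r"
proof -
  let ?X = "{U :: 'b set. ultrafilter U}"
  \<comment> \<open>Maximality makes distinct ultrafilters incomparable.\<close>
  have "\<exists>s. s \<in> U \<and> s \<notin> V" if "ultrafilter U" "ultrafilter V" "U \<noteq> V" for U V :: "'b set"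
    using that unfolding ultrafilter_def by blast
  then obtain s where s: "\<And>U V :: 'b set. ultrafilter U \<Longrightarrow> ultrafilter V \<Longrightarrow> U \<noteq> V \<Longrightarrow>
      s U V \<in> U \<and> s U V \<notin> V"
    by metis
  \<comment> \<open>One separating element for each ordered pair of ultrafilters. Finite joins of
    the finite meets collected in \<open>M\<close> will exhaust the algebra.\<close>
  define S where "S = (\<lambda>(U, V). s U V) ` (?X \<times> ?X)"
  define M where "M = (\<lambda>xs. foldr inf xs top) ` lists S"
  have "|?X \<times> ?X| \<le>o r"
    using r X by (auto simp: cinfinite_def intro: card_of_Times_ordLeq_infinite_Field)
  then have "|S| \<le>o r" unfolding S_def by (blast intro: card_of_image ordLeq_transitive)
  then have "|lists S| \<le>o r" by (rule card_of_lists_ordLeq[OF r])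
  then have "|M| \<le>o r" unfolding M_def by (blast intro: card_of_image ordLeq_transitive)
  then have lM: "|lists M| \<le>o r" by (rule card_of_lists_ordLeq[OF r])
  have "\<exists>ys\<in>lists M. b = foldr sup ys bot" for b
  proof -
    have "\<exists>m\<in>M. m \<in> U \<and> m \<le> b" if U: "ultrafilter U" "b \<in> U" for U
    proof (rule ccontr)
      assume no: "\<not> ?thesis"
      have pf: "proper_filter U" using U by (simp add: ultrafilter_def)
      \<comment> \<open>Each ultrafilter \<open>V\<close> omitting \<open>b\<close> lacks
        \<open>s U V\<close>, so none contains all of \<open>T\<close>. Yet if no finite meet from
        \<open>T\<close> lay below \<open>b\<close>, then \<open>T\<close> together with
        \<open>- b\<close> would extend to one.\<close>
      define T where "T = {s U V | V. ultrafilter V \<and> b \<notin> V}"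
      have TU: "T \<subseteq> U" and TS: "T \<subseteq> S"
        using s U by (auto simp: T_def S_def image_iff)
      have "foldr inf xs top \<noteq> bot" if xs: "xs \<in> lists (insert (- b) T)" for xs
      proof
        assume "foldr inf xs top = bot"
        then obtain ys where ys: "ys \<in> lists T" "inf (- b) (foldr inf ys top) \<le> bot"
          using foldr_inf_insert[OF xs] by auto
        then have "foldr inf ys top \<le> b"
          by (simp add: bot_unique inf_commute[of "- b"] inf_shunt)
        moreover have "ys \<in> lists S" "ys \<in> lists U" using ys TS TU by auto
        then have "foldr inf ys top \<in> M" "foldr inf ys top \<in> U"
          using foldr_inf_mem_filter[OF pf] by (auto simp: M_def)
        ultimately show False using no by blast
      qed
      then obtain W where W: "ultrafilter W" "insert (- b) T \<subseteq> W"
        by (rule ultrafilter_extends)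
      then have "b \<notin> W" using ultrafilter_uminus by blast
      with W U s[of U W] show False by (auto simp: T_def)
    qed
    then obtain m where m: "\<And>U. ultrafilter U \<Longrightarrow> b \<in> U \<Longrightarrow> m U \<in> M \<and> m U \<in> U \<and> m U \<le> b"
      by metis
    define T where "T = m ` {U. ultrafilter U \<and> b \<in> U}"
    \<comment> \<open>Compactness again: otherwise some ultrafilter \<open>W\<close> contains
      \<open>b\<close> and the complements of all members of \<open>T\<close>, against
      \<open>m W \<in> W\<close>.\<close>
    have "\<exists>ys\<in>lists T. b \<le> foldr sup ys bot"
    proof (rule ccontr)
      assume no: "\<not> ?thesis"
      have "foldr inf xs top \<noteq> bot" if xs: "xs \<in> lists (insert b (uminus ` T))" for xs
      proof
        assume "foldr inf xs top = bot"
        then obtain ys where ys: "ys \<in> lists (uminus ` T)" "inf b (foldr inf ys top) \<le> bot"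
          using foldr_inf_insert[OF xs] by auto
        then obtain zs where zs: "zs \<in> lists T" "ys = map uminus zs"
          by (metis imageE lists_image)
        then have "b \<le> foldr sup zs bot"
          using ys by (simp add: foldr_inf_uminus bot_unique inf_shunt)
        then show False using no zs by blast
      qed
      then obtain W where W: "ultrafilter W" "insert b (uminus ` T) \<subseteq> W"
        by (rule ultrafilter_extends)
      then have "m W \<in> T" "m W \<in> W" using m by (auto simp: T_def)
      with W show False using ultrafilter_uminus[of W "m W"] by auto
    qed
    then obtain ys where ys: "ys \<in> lists T" "b \<le> foldr sup ys bot" by blast
    moreover have "foldr sup ys bot \<le> b"
      using ys m by (intro foldr_sup_least) (auto simp: T_def in_lists_conv_set)
    moreover have "ys \<in> lists M" using ys m by (auto simp: T_def in_lists_conv_set)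
    ultimately show ?thesis by (blast intro: order_antisym)
  qed
  then have "UNIV \<subseteq> (\<lambda>ys. foldr sup ys bot) ` lists M" by auto
  then show ?thesis using lM by (blast intro: surj_imp_ordLeq ordLeq_transitive)
qed

section \<open>Cardinal exponentiation\<close>

lemma cexp_idem:
  assumes "Card_order p" "Cinfinite r" "|B| =o p ^c r"
  shows "|B| ^c r =o |B|"
proof -
  have "|B| ^c r =o (p ^c r) ^c r"
    using assms by (intro cexp_cong1) auto
  \<comment> \<open>The iterated power has exponent r * r, which equals r for infinite r.\<close>
  also have "(p ^c r) ^c r =o p ^c r"
    using assms by (intro cexp_cprod_ordLeq Cinfinite_Cnotzero ordLeq_refl) auto
  also have "p ^c r =o |B|"
    using assms by (blast intro: ordIso_symmetric)
  finally show ?thesis .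
qed

lemma card_of_Pow_ordLeq:
  assumes "|A| \<le>o r" "Cinfinite r"
  shows "|Pow A| \<le>o ctwo ^c r"
proof -
  have "|A| \<le>o |Field r|"
    using assms card_of_Field_ordIso ordLeq_ordIso_trans ordIso_symmetric by blast
  then obtain f where f: "inj_on f A" "f ` A \<subseteq> Field r"
    unfolding card_of_ordLeq[symmetric] by blast
  then have "|Pow A| \<le>o |Pow (Field r)|"
    by (intro card_of_ordLeqI[where f = "image f"] inj_on_image_Pow) auto
  also have "|Pow (Field r)| =o ctwo ^c r"
    unfolding ctwo_def cexp_def Field_card_of by (rule card_of_Pow_Func)
  finally show ?thesis .
qed

section \<open>The quotient and its ideal of small images\<close>

locale B_alg_quotient =
  fixes kappa :: "'k rel" and lambda :: "'l rel" and h :: "'k set \<Rightarrow> 'b::boolean_algebra"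
  assumes lambda: "Cinfinite lambda"
    and hom: "set_algebra_hom (Field kappa) (B_alg kappa lambda) h"
    and onto: "h ` B_alg kappa lambda = UNIV"
begin

abbreviation small :: "'k set set" where
  "small \<equiv> small_sets kappa lambda"

lemma small_mono: "y \<in> small \<Longrightarrow> x \<subseteq> y \<Longrightarrow> x \<in> small"
  using card_of_mono1[of x y] ordLeq_transitive[of "|x|" "|y|" lambda]
  by (auto simp: small_sets_def)

lemma empty_small: "{} \<in> small"
  using lambda by (auto simp: small_sets_def card_of_empty1 card_order_on_well_order_on)

lemma UN_small: "|I| \<le>o lambda \<Longrightarrow> (\<And>i. i \<in> I \<Longrightarrow> A i \<in> small) \<Longrightarrow> (\<Union>i\<in>I. A i) \<in> small"
  using lambda by (auto simp: small_sets_def intro!: UNION_Cinfinite_bound)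

lemma small_B_alg: "x \<in> small \<Longrightarrow> x \<in> B_alg kappa lambda"
  using lambda by (simp add: B_alg_explicit)

lemma h_empty: "h {} = bot"
  using hom by (simp add: set_algebra_hom_def)

lemma h_Un: "x \<in> small \<Longrightarrow> y \<in> small \<Longrightarrow> h (x \<union> y) = sup (h x) (h y)"
  using hom small_B_alg by (simp add: set_algebra_hom_def)

lemma h_Int: "x \<in> small \<Longrightarrow> y \<in> B_alg kappa lambda \<Longrightarrow> h (x \<inter> y) = inf (h x) (h y)"
  using hom small_B_alg by (simp add: set_algebra_hom_def)

lemma mem_ideal_cases: "b \<in> h ` small \<or> - b \<in> h ` small"
proof -
  obtain x where x: "x \<in> B_alg kappa lambda" "b = h x"
    using onto by blast
  moreover from this have "h (Field kappa - x) = - b"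
    using hom by (simp add: set_algebra_hom_def)
  ultimately show ?thesis
    using B_alg_explicit[OF lambda, of kappa] by (metis (no_types, lifting) UnE image_eqI mem_Collect_eq)
qed

text \<open>The ideal and its image under complementation cover the algebra, so an infinite bound on
  the ideal carries over.\<close>

lemma card_of_algebra_ordLeq:
  assumes r: "Cinfinite r" and J: "|h ` small| \<le>o r"
  shows "|UNIV :: 'b set| \<le>o r"
proof -
  have "|uminus ` h ` small| \<le>o r"
    using J card_of_image ordLeq_transitive by blast
  moreover have "UNIV = h ` small \<union> uminus ` h ` small"
    using mem_ideal_cases by (auto simp: image_iff) (metis double_compl)
  ultimately show ?thesis using Un_Cinfinite_bound[OF J _ r] by metis
qed

text \<open>If \<open>h y \<le> h x\<close>, then \<open>h y = h (x \<inter> y)\<close>, so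
  everything below \<open>h x\<close> is the image of one of the at most 2^lambda subsets of
  \<open>x\<close>.\<close>

lemma card_of_below_ordLeq:
  assumes x: "x \<in> small"
  shows "|{b. b \<le> h x}| \<le>o ctwo ^c lambda"
proof -
  have "{b. b \<le> h x} \<subseteq> h ` Pow x"
  proof
    fix b assume "b \<in> {b. b \<le> h x}"
    moreover obtain y where y: "y \<in> B_alg kappa lambda" "b = h y"
      using onto by blast
    ultimately have "b = h (x \<inter> y)"
      using x by (simp add: h_Int inf_absorb2)
    then show "b \<in> h ` Pow x" by blast
  qed
  moreover have "|Pow x| \<le>o ctwo ^c lambda"
    using x lambda by (intro card_of_Pow_ordLeq) (auto simp: small_sets_def)
  ultimately show ?thesis by (blast intro: surj_imp_ordLeq ordLeq_transitive)
qed

section \<open>Counting the ultrafilters of the quotient\<close>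

lemma card_of_ultrafilters_containing_ordLeq:
  assumes x: "x \<in> small"
  shows "|{U. ultrafilter U \<and> h x \<in> U}| \<le>o ctwo ^c (ctwo ^c lambda)"
proof -
  have "|{U. ultrafilter U \<and> h x \<in> U}| \<le>o |Pow {b. b \<le> h x}|"
  proof (rule card_of_ordLeqI[where f = "\<lambda>U. U \<inter> {b. b \<le> h x}"])
    \<comment> \<open>Meeting with \<open>h x\<close> reduces membership of any \<open>b\<close> to
      membership of an element below \<open>h x\<close>; hence the trace determines
      \<open>U\<close>.\<close>
    have mem: "b \<in> U \<longleftrightarrow> inf b (h x) \<in> U \<inter> {b. b \<le> h x}"
      if "ultrafilter U" "h x \<in> U" for U b
      using that unfolding ultrafilter_def proper_filter_def
      by (metis IntE IntI inf.cobounded1 inf.cobounded2 mem_Collect_eq)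
    show "inj_on (\<lambda>U. U \<inter> {b. b \<le> h x}) {U. ultrafilter U \<and> h x \<in> U}"
      by (rule inj_onI) (metis (mono_tags, lifting) mem mem_Collect_eq subset_antisym subsetI)
  qed auto
  also have "|Pow {b. b \<le> h x}| \<le>o ctwo ^c (ctwo ^c lambda)"
    using lambda x ordLess_imp_ordLeq[OF ctwo_ordLess_Cinfinite]
    by (intro card_of_Pow_ordLeq card_of_below_ordLeq Cinfinite_cexp ordLeq_refl Card_order_ctwo) auto
  finally show ?thesis .
qed

lemma card_of_ultrafilters_ordLeq:
  assumes r: "Cinfinite r" and B: "|UNIV :: 'b set| \<le>o r"
    and exp: "ctwo ^c (ctwo ^c lambda) \<le>o r"
  shows "|{U :: 'b set. ultrafilter U}| \<le>o r"
proof -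
  have sub: "{U :: 'b set. ultrafilter U}
      \<subseteq> {- (h ` small)} \<union> (\<Union>j\<in>h ` small. {U. ultrafilter U \<and> j \<in> U})"
  proof
    fix U :: "'b set" assume "U \<in> {U. ultrafilter U}"
    then have U: "ultrafilter U" by simp
    show "U \<in> {- (h ` small)} \<union> (\<Union>j\<in>h ` small. {U. ultrafilter U \<and> j \<in> U})"
    proof (cases "U \<inter> h ` small = {}")
      case True
      \<comment> \<open>An element outside the ideal has its complement in the ideal, hence outside
        \<open>U\<close>, so it lies in \<open>U\<close> itself. Thus \<open>U\<close> is the
        set-theoretic complement of the ideal.\<close>
      have "b \<in> U \<longleftrightarrow> b \<notin> h ` small" for b
        using True mem_ideal_cases[of b] ultrafilter_uminus[OF U, of b] by blast
      then have "U = - (h ` small)" by blast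
      then show ?thesis by simp
    next
      case False
      then show ?thesis using U by blast
    qed
  qed
  have "|h ` small| \<le>o r"
    using B card_of_mono1[of "h ` small" UNIV] ordLeq_transitive by blast
  then have "|\<Union>j\<in>h ` small. {U. ultrafilter U \<and> j \<in> U}| \<le>o r"
    using ordLeq_transitive[OF card_of_ultrafilters_containing_ordLeq exp]
    by (intro UNION_Cinfinite_bound r) auto
  moreover have "|{- (h ` small)}| \<le>o r"
    using r by (rule singleton_Cinfinite_bound)
  ultimately have
    "|{- (h ` small)} \<union> (\<Union>j\<in>h ` small. {U. ultrafilter U \<and> j \<in> U})| \<le>o r"
    using Un_Cinfinite_bound r by blast
  then show ?thesis
    by (rule ordLeq_transitive[OF card_of_mono1[OF sub]])
qed

section \<open>Disjoint families and the cardinality of the quotient\<close>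

lemma maximal_disjoint_family:
  obtains D where "D \<subseteq> small" "\<And>d. d \<in> D \<Longrightarrow> h d \<noteq> bot" "disjoint D"
    "\<And>y. y \<in> small \<Longrightarrow> h (y \<inter> \<Union>D) = h y"
proof -
  define P where "P = {D. D \<subseteq> small \<and> (\<forall>d\<in>D. h d \<noteq> bot) \<and> disjoint D}"
  have "\<exists>D\<in>P. \<forall>X\<in>P. D \<subseteq> X \<longrightarrow> X = D"
  proof (rule subset_Zorn')
    fix C assume C: "subset.chain P C"
    then have "disjoint (\<Union>C)"
      by (intro pairwise_chain_Union) (auto simp: P_def subset_chain_def chain_subset_def)
    with C show "\<Union>C \<in> P" by (auto simp: P_def subset_chain_def)
  qed
  then obtain D where D: "D \<subseteq> small" "\<And>d. d \<in> D \<Longrightarrow> h d \<noteq> bot" "disjoint D"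
    and max: "\<And>X. X \<in> P \<Longrightarrow> D \<subseteq> X \<Longrightarrow> X = D"
    by (auto simp: P_def)
  have "h (y \<inter> \<Union>D) = h y" if y: "y \<in> small" for y
  proof -
    have bot: "h (y - \<Union>D) = bot"
    proof (rule ccontr)
      assume ne: "h (y - \<Union>D) \<noteq> bot"
      then have "insert (y - \<Union>D) D \<in> P"
        using D small_mono[OF y, of "y - \<Union>D"]
        by (auto simp: P_def pairwise_insert disjnt_def)
      \<comment> \<open>A member of \<open>D\<close> is contained in \<open>\<Union>D\<close>, but
        this one is also disjoint from it, so it is empty and its image is
        \<open>bot\<close>.\<close>
      then have "y - \<Union>D \<in> D" using max by blast
      then have "y - \<Union>D = {}" by blast
      then show False using ne h_empty by (simp only:)
    qed
    have "h y = h ((y \<inter> \<Union>D) \<union> (y - \<Union>D))" by (simp add: Int_Diff_Un)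
    also have "\<dots> = sup (h (y \<inter> \<Union>D)) (h (y - \<Union>D))"
      using y by (intro h_Un small_mono[OF y]) auto
    finally show ?thesis using bot by simp
  qed
  then show ?thesis using that D by blast
qed

text \<open>A member \<open>d\<close> of \<open>E\<close> outside \<open>F\<close> is disjoint from
  \<open>\<Union>F\<close>, so meeting both sides of the equation with \<open>h d\<close> gives
  \<open>h d = bot\<close>. The size bounds keep the unions in the domain of \<open>h\<close>. One
  inclusion is enough for comparing coded graphs below.\<close>

lemma h_UN_inj:
  assumes D: "D \<subseteq> small" "\<And>d. d \<in> D \<Longrightarrow> h d \<noteq> bot" "disjoint D"
    and E: "E \<subseteq> D" "|E| \<le>o lambda" and F: "F \<subseteq> D" "|F| \<le>o lambda"
    and eq: "h (\<Union>E) = h (\<Union>F)"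
  shows "E \<subseteq> F"
proof
  fix d assume d: "d \<in> E"
  show "d \<in> F"
  proof (rule ccontr)
    assume nd: "d \<notin> F"
    have sm: "d \<in> small" "\<Union>E \<in> small" "\<Union>F \<in> small"
      using D E F d UN_small[of E id] UN_small[of F id] by auto
    have "h d = h (d \<inter> \<Union>E)" using d by (simp add: Union_upper inf_absorb1)
    also have "\<dots> = h (d \<inter> \<Union>F)" using sm eq by (simp add: h_Int small_B_alg)
    also have "d \<inter> \<Union>F = {}"
    proof -
      have "d \<inter> e = {}" if "e \<in> F" for e
        using pairwiseD[OF D(3), of d e] that E(1) F(1) d nd by (auto simp: disjnt_def)
      then show ?thesis by blast
    qed
    finally show False using D(2) E d h_empty by auto
  qed
qed

text \<open>The second alternative is an exact power, not just a pair of bounds, so that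
  \<open>cexp_idem\<close> applies to it.\<close>

lemma card_of_algebra:
  "|UNIV :: 'b set| \<le>o ctwo ^c lambda \<or> (\<exists>D :: 'k set set. |UNIV :: 'b set| =o |D| ^c lambda)"
proof -
  obtain D where D: "D \<subseteq> small" "\<And>d. d \<in> D \<Longrightarrow> h d \<noteq> bot" "disjoint D"
    and tr: "\<And>y. y \<in> small \<Longrightarrow> h (y \<inter> \<Union>D) = h y"
    by (rule maximal_disjoint_family) blast
  have wo: "Well_order lambda" using lambda card_order_on_well_order_on by blast
  have L: "|Field lambda| =o lambda" using lambda card_of_Field_ordIso by blast
  have exp: "Cinfinite (ctwo ^c lambda)"
    using lambda by (intro Cinfinite_cexp ordLeq_refl Card_order_ctwo)
  show ?thesis
  proof (cases "|D| \<le>o lambda")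
    case True
    \<comment> \<open>Now \<open>\<Union>D\<close> is itself small, and its subsets already produce
      the whole ideal.\<close>
    then have S: "\<Union>D \<in> small" using D UN_small[of D id] by auto
    have "h ` small \<subseteq> h ` Pow (\<Union>D)"
      using tr by (metis (no_types, lifting) Int_lower2 PowI image_eqI image_subsetI)
    moreover have "|Pow (\<Union>D)| \<le>o ctwo ^c lambda"
      using S lambda by (intro card_of_Pow_ordLeq) (auto simp: small_sets_def)
    ultimately have "|h ` small| \<le>o ctwo ^c lambda"
      by (blast intro: surj_imp_ordLeq ordLeq_transitive)
    then show ?thesis using card_of_algebra_ordLeq[OF exp] by blast
  next
    case False
    then have le: "lambda \<le>o |D|"
      using wo card_of_Well_order not_ordLeq_iff_ordLess ordLess_imp_ordLeq by blast
    have infD: "Cinfinite |D|" using le lambda cinfinite_mono card_of_Card_order by blast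
    have cexp: "|D| ^c lambda = |Func (Field lambda) D|"
      by (simp add: cexp_def Field_card_of)
    have infT: "Cinfinite ( |D| ^c lambda)"
      using infD lambda ctwo_ordLeq_Cinfinite by (intro Cinfinite_cexp)
    have lower: "|D| ^c lambda \<le>o |UNIV :: 'b set|"
    proof -
      have "|D \<times> Field lambda| \<le>o |D|"
        using infD ordIso_ordLeq_trans[OF L le] ordLeq_refl[OF card_of_Card_order]
        by (intro card_of_Times_ordLeq_infinite_Field) (auto simp: cinfinite_def)
      then obtain p where p: "inj_on p (D \<times> Field lambda)" "p ` (D \<times> Field lambda) \<subseteq> D"
        unfolding card_of_ordLeq[symmetric] by blast
      \<comment> \<open>Since \<open>p\<close> codes pairs injectively by members of
        \<open>D\<close>, \<open>G f\<close> codes the graph of \<open>f\<close> as a subfamily of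
        \<open>D\<close>. The range of \<open>f\<close> alone would not determine
        \<open>f\<close>.\<close>
      define G where "G f = (\<lambda>i. p (f i, i)) ` Field lambda" for f
      have G: "G f \<subseteq> D" "|G f| \<le>o lambda" if "f \<in> Func (Field lambda) D" for f
      proof -
        show "G f \<subseteq> D" using that p by (auto simp: G_def Func_def)
        show "|G f| \<le>o lambda"
          unfolding G_def using card_of_image L ordLeq_ordIso_trans by blast
      qed
      have "inj_on (\<lambda>f. h (\<Union>(G f))) (Func (Field lambda) D)"
      proof (rule inj_onI)
        fix f g assume f: "f \<in> Func (Field lambda) D" and g: "g \<in> Func (Field lambda) D"
          and eq: "h (\<Union>(G f)) = h (\<Union>(G g))"
        have sub: "G f \<subseteq> G g"
          using h_UN_inj[OF D G[OF f] G[OF g] eq] .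
        \<comment> \<open>Decoding forces equal indices, so inclusion between graphs over the same
          domain already gives equality.\<close>
        have "f i = g i" if i: "i \<in> Field lambda" for i
        proof -
          obtain j where j: "j \<in> Field lambda" "p (f i, i) = p (g j, j)"
            using sub i by (auto simp: G_def)
          moreover have "f i \<in> D" "g j \<in> D" using f g i j by (auto simp: Func_def)
          ultimately show ?thesis using p(1) i by (auto dest: inj_onD)
        qed
        moreover have "f i = g i" if "i \<notin> Field lambda" for i
          using that f g by (simp add: Func_def)
        ultimately show "f = g" by blast
      qed
      then show ?thesis unfolding cexp by (rule card_of_ordLeqI) simp
    qed
    have "|h ` small| \<le>o |D| ^c lambda"
    proof -
      \<comment> \<open>Every nonempty subset of \<open>\<Union>D\<close> of size at most
        \<open>lambda\<close> is the range of such a function. The empty set is not, as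
        \<open>Field lambda\<close> is infinite; it is adjoined separately.\<close>
      define Y where "Y = (\<lambda>f. f ` Field lambda) ` Func (Field lambda) (\<Union>D)"
      have S: "|\<Union>D| \<le>o |D|"
      proof -
        have "\<forall>d\<in>D. |id d| \<le>o |D|"
          using D(1) ordLeq_transitive[OF _ le] by (auto simp: small_sets_def)
        then show ?thesis
          using UNION_Cinfinite_bound[of D "|D|" id] infD ordLeq_refl[OF card_of_Card_order, of D]
          by simp
      qed
      have sub: "h ` small \<subseteq> h ` (insert {} Y)"
      proof (rule image_subsetI)
        fix y assume y: "y \<in> small"
        define z where "z = y \<inter> \<Union>D"
        have "z \<in> insert {} Y"
        proof (cases "z = {}")
          case False
          have "z \<in> small" using y small_mono by (auto simp: z_def)
          then have "|z| \<le>o |Field lambda|"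
            using L by (auto simp: small_sets_def intro: ordLeq_ordIso_trans ordIso_symmetric)
          then obtain g where g: "g ` Field lambda = z"
            using card_of_ordLeq2[OF False, of "Field lambda"] by auto
          define f where "f i = (if i \<in> Field lambda then g i else undefined)" for i
          have "f \<in> Func (Field lambda) (\<Union>D)" "f ` Field lambda = z"
            using g by (auto simp: f_def Func_def z_def)
          then show ?thesis unfolding Y_def by blast
        qed simp
        then show "h y \<in> h ` (insert {} Y)"
          using tr[OF y] unfolding z_def by (metis image_eqI)
      qed
      have "|Y| \<le>o |D| ^c lambda"
      proof -
        have "|Y| \<le>o |\<Union>D| ^c lambda"
          unfolding Y_def cexp_def Field_card_of by (rule card_of_image)
        also have "|\<Union>D| ^c lambda \<le>o |D| ^c lambda"
          using S lambda by (intro cexp_mono1) auto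
        finally show ?thesis .
      qed
      then have "|{{}} \<union> Y| \<le>o |D| ^c lambda"
        using infT by (intro Un_Cinfinite_bound singleton_Cinfinite_bound)
      then show ?thesis using ordLeq_transitive[OF surj_imp_ordLeq[OF sub]] by simp
    qed
    then have "|UNIV :: 'b set| \<le>o |D| ^c lambda" by (rule card_of_algebra_ordLeq[OF infT])
    then show ?thesis using lower ordIso_iff_ordLeq by blast
  qed
qed

section \<open>The two dichotomies\<close>

lemma card_of_algebra_dichotomy:
  "|UNIV :: 'b set| <o ctwo ^c lambda \<or> |UNIV :: 'b set| ^c lambda =o |UNIV :: 'b set|"
  using card_of_algebra
proof
  assume "|UNIV :: 'b set| \<le>o ctwo ^c lambda"
  \<comment> \<open>Either the bound is strict, or the algebra has exactly 2^lambda elements, a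
    cardinal fixed by exponentiation with \<open>lambda\<close>.\<close>
  then show ?thesis
    using cexp_idem[OF Card_order_ctwo lambda] ordLeq_iff_ordLess_or_ordIso by blast
next
  assume "\<exists>D :: 'k set set. |UNIV :: 'b set| =o |D| ^c lambda"
  then show ?thesis using cexp_idem[OF card_of_Card_order lambda] by blast
qed

text \<open>With more than 2^2^lambda ultrafilters, the algebra must also exceed 2^2^lambda. The two
  counting bounds, taken at \<open>r\<close> equal to the size of the algebra and of the space, then
  give equality, and the first alternative of \<open>card_of_algebra_dichotomy\<close> is
  excluded.\<close>

lemma card_of_stone_space_dichotomy:
  "|topspace (stone_space :: 'b set topology)| \<le>o ctwo ^c (ctwo ^c lambda)
   \<or> |topspace (stone_space :: 'b set topology)| =o |UNIV :: 'b set|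
     \<and> |UNIV :: 'b set| =o |UNIV :: 'b set| ^c lambda"
proof (unfold disj_imp, rule impI)
  let ?X = "{U :: 'b set. ultrafilter U}" and ?E = "ctwo ^c (ctwo ^c lambda)"
  assume "\<not> |topspace (stone_space :: 'b set topology)| \<le>o ?E"
  then have nle: "\<not> |?X| \<le>o ?E" by (simp add: topspace_stone_space)
  have E1: "Cinfinite (ctwo ^c lambda)" and E2: "Cinfinite ?E"
    using lambda by (auto intro!: Cinfinite_cexp ordLeq_refl Card_order_ctwo)
  have "?E \<le>o |?X|"
    using nle E2 card_of_Well_order not_ordLeq_iff_ordLess ordLess_imp_ordLeq
      card_order_on_well_order_on by blast
  then have infX: "Cinfinite |?X|" using E2 cinfinite_mono card_of_Card_order by blast
  have "\<not> |UNIV :: 'b set| \<le>o ?E"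
    using nle card_of_ultrafilters_ordLeq[OF E2] E2 by (auto intro: ordLeq_refl)
  then have EB: "?E \<le>o |UNIV :: 'b set|"
    using E2 card_of_Well_order not_ordLeq_iff_ordLess ordLess_imp_ordLeq
      card_order_on_well_order_on by blast
  then have "Cinfinite |UNIV :: 'b set|" using E2 cinfinite_mono card_of_Card_order by blast
  then have "|?X| \<le>o |UNIV :: 'b set|"
    using EB by (intro card_of_ultrafilters_ordLeq ordLeq_refl[OF card_of_Card_order])
  moreover have "|UNIV :: 'b set| \<le>o |?X|"
    using infX by (rule card_of_algebra_ordLeq_ultrafilters) (rule ordLeq_refl[OF card_of_Card_order])
  ultimately have "|?X| =o |UNIV :: 'b set|" using ordIso_iff_ordLeq by blast
  moreover have "ctwo ^c lambda \<le>o ?E"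
    using E1 by (intro ordLeq_cexp2 ordLeq_refl Card_order_ctwo) auto
  then have "\<not> |UNIV :: 'b set| <o ctwo ^c lambda"
    using EB by (meson not_ordLess_ordLeq ordLeq_transitive)
  ultimately show "|topspace (stone_space :: 'b set topology)| =o |UNIV :: 'b set|
      \<and> |UNIV :: 'b set| =o |UNIV :: 'b set| ^c lambda"
    using card_of_algebra_dichotomy ordIso_symmetric by (auto simp: topspace_stone_space)
qed

end

theorem theorem3:
  fixes kappa :: "'k rel" and lambda :: "'l rel"
    and h :: "'k set \<Rightarrow> 'b::boolean_algebra"
  assumes kappa: "Card_order kappa"
    and lambda: "Cinfinite lambda"
    and hom: "set_algebra_hom (Field kappa) (B_alg kappa lambda) h"
    and onto: "h ` B_alg kappa lambda = UNIV"
  shows "( |UNIV :: 'b set| <o ctwo ^c lambda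
           \<or> |UNIV :: 'b set| ^c lambda =o |UNIV :: 'b set| )
       \<and> ( |topspace (stone_space :: 'b set topology)| \<le>o ctwo ^c (ctwo ^c lambda)
           \<or> ( |topspace (stone_space :: 'b set topology)| =o |UNIV :: 'b set|
               \<and> |UNIV :: 'b set| =o |UNIV :: 'b set| ^c lambda ) )"
proof -
  interpret B_alg_quotient kappa lambda h
    using lambda hom onto by unfold_locales
  show ?thesis
    using card_of_algebra_dichotomy card_of_stone_space_dichotomy by blast
qed

end
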